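(* Let $(X,T)$ be a non-trivial weakly mixing dynamical system and let $n\geq 2$. Then $(X,T)$ is $n$-tuplewise thickly sensitive if and only if it has at least $n$ minimal points.
   Context: A dynamical system is a pair $(X,T)$ where $X$ is a compact metric space with metric $d$ and $T\colon X\to X$ is a continuous surjection; it is non-trivial if $X$ is not a singleton. $\mathbb{N}$ is the set of positive integers. For a point $x$, $\omega(x,T)$ denotes the set of limit points of the sequence $(T^kx)_{k\ge 1}$, i.e. of all limits of $T^{k_i}x$ with $k_i\to\infty$. A system $(X,T)$ is transitive if there is $x\in X$ with $\omega(x,T)=X$; it is weakly mixing if the product system $(X\times X,T\times T)$ is transitive. A subsystem is a non-empty closed $Y\subset X$ with $TY\subset Y$; a system is minimal if it has no proper subsystem. A point $x\in X$ is minimal if its orbit closure $\overline{\{T^kx:k\ge0\}}$ is a minimal subsystem. A set $F\subset\mathbb{N}$ is thick if for every $L\in\mathbb{N}$ there is $m\in\mathbb{N}$ with $\{m,m+1,\dots,m+L\}\subset F$. For $n\ge2$, $(X,T)$ is $n$-tuplewise thickly sensitive if there is a constant $\delta>0$ such that for every non-empty open $U\subset X$ there exist $x_1,\dots,x_n\in U$ such that $\{k\in\mathbb{N}: \min_{1\le i<j\le n}d(T^kx_i,T^kx_j)>\delta\}$ is thick. *)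

theory Defs
  imports "HOL-Analysis.Analysis"
begin

text \<open>A compact metric space is represented by a compact subset \<open>X\<close> of a metric space type; the
  map \<open>T\<close> is a function on the whole type of which only the values on \<open>X\<close> matter.\<close>

definition dynamical_system :: "'a::metric_space set \<Rightarrow> ('a \<Rightarrow> 'a) \<Rightarrow> bool" where
  "dynamical_system X T \<longleftrightarrow> compact X \<and> continuous_on X T \<and> T ` X = X"

definition nontrivial_system :: "'a::metric_space set \<Rightarrow> bool" where
  "nontrivial_system X \<longleftrightarrow> \<not> (\<exists>x. X = {x})"

text \<open>The times \<open>k i\<close> only have to tend to infinity. Limits are taken in the ambient type; for
  \<open>x \<in> X\<close> they lie in \<open>X\<close>, because \<open>X\<close> is closed and invariant.\<close>

definition omega_limit :: "('a::metric_space \<Rightarrow> 'a) \<Rightarrow> 'a \<Rightarrow> 'a set" where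
  "omega_limit T x =
    {y. \<exists>k :: nat \<Rightarrow> nat. filterlim k at_top sequentially \<and> (\<lambda>i. (T ^^ k i) x) \<longlonglongrightarrow> y}"

definition transitive_system :: "'a::metric_space set \<Rightarrow> ('a \<Rightarrow> 'a) \<Rightarrow> bool" where
  "transitive_system X T \<longleftrightarrow> (\<exists>x\<in>X. omega_limit T x = X)"

text \<open>The library metric on \<open>'a \<times> 'a\<close> induces the product topology, and transitivity depends
  on the topology only.\<close>

definition weakly_mixing :: "'a::metric_space set \<Rightarrow> ('a \<Rightarrow> 'a) \<Rightarrow> bool" where
  "weakly_mixing X T \<longleftrightarrow> transitive_system (X \<times> X) (map_prod T T)"

definition subsystem :: "'a::metric_space set \<Rightarrow> ('a \<Rightarrow> 'a) \<Rightarrow> 'a set \<Rightarrow> bool" where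
  "subsystem X T Y \<longleftrightarrow> Y \<noteq> {} \<and> closedin (top_of_set X) Y \<and> T ` Y \<subseteq> Y"

definition minimal_system :: "'a::metric_space set \<Rightarrow> ('a \<Rightarrow> 'a) \<Rightarrow> bool" where
  "minimal_system X T \<longleftrightarrow> \<not> (\<exists>Y. subsystem X T Y \<and> Y \<noteq> X)"

definition orbit_closure :: "('a::metric_space \<Rightarrow> 'a) \<Rightarrow> 'a \<Rightarrow> 'a set" where
  "orbit_closure T x = closure {(T ^^ k) x | k. True}"

definition minimal_point :: "'a::metric_space set \<Rightarrow> ('a \<Rightarrow> 'a) \<Rightarrow> 'a \<Rightarrow> bool" where
  "minimal_point X T x \<longleftrightarrow>
    x \<in> X \<and> subsystem X T (orbit_closure T x) \<and> minimal_system (orbit_closure T x) T"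

text \<open>Times range over the positive integers, hence the lower bounds 1 on \<open>L\<close>, \<open>m\<close> and, below, \<open>k\<close>.\<close>

definition thick :: "nat set \<Rightarrow> bool" where
  "thick F \<longleftrightarrow> (\<forall>L\<ge>1. \<exists>m\<ge>1. {m..m + L} \<subseteq> F)"

text \<open>Intended for \<open>n \<ge> 2\<close>, when the minimum is over a non-empty set.\<close>

definition tuplewise_thickly_sensitive ::
  "nat \<Rightarrow> 'a::metric_space set \<Rightarrow> ('a \<Rightarrow> 'a) \<Rightarrow> bool" where
  "tuplewise_thickly_sensitive n X T \<longleftrightarrow>
    (\<exists>\<delta>>0. \<forall>U. openin (top_of_set X) U \<and> U \<noteq> {} \<longrightarrow>
      (\<exists>x :: nat \<Rightarrow> 'a. (\<forall>i\<in>{1..n}. x i \<in> U) \<and>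
        thick {k. 1 \<le> k \<and>
          Min {dist ((T ^^ k) (x i)) ((T ^^ k) (x j)) | i j. 1 \<le> i \<and> i < j \<and> j \<le> n} > \<delta>}))"

end

theory Submission
  imports Defs
begin

text \<open>Pass to limits along longer and longer windows of times at which the images of
  \<open>x\<^sub>1, \<dots>, x\<^sub>n\<close> are \<open>\<delta>\<close>-separated. This gives a tuple whose orbit under \<open>T \<times> \<dots> \<times> T\<close> stays
  \<open>\<delta>\<close>-separated forever. A minimal set in its orbit closure contains a tuple of distinct points, and
  the coordinates of a minimal point of a product system are minimal.

  Conversely, \<open>n\<close> minimal points yield \<open>n\<close> points \<open>q\<^sub>i\<close> whose orbits stay uniformly apart: the given
  points if all of them are periodic, and \<open>T x, \<dots>, T\<^sup>n x\<close> for a minimal point \<open>x\<close> that is not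
  periodic, since its orbit closure then contains no periodic point at all. Weak mixing lets the \<open>n\<close>
  points of \<open>U\<close> visit small neighbourhoods of \<open>q\<^sub>1, \<dots>, q\<^sub>n\<close> at a common time, after which they shadow
  the separated orbits for as long as desired.\<close>

section \<open>Iterates of a map on an invariant set\<close>

lemma funpow_invariant:
  assumes "f ` S \<subseteq> S" "x \<in> S"
  shows "(f ^^ k) x \<in> S"
  using assms by (induction k) auto

lemma continuous_on_funpow_invariant:
  assumes "continuous_on S f" "f ` S \<subseteq> S"
  shows "continuous_on S (f ^^ k)"
proof (induction k)
  case (Suc k)
  have "(f ^^ k) ` S \<subseteq> S"
    using assms(2) by (auto intro: funpow_invariant)
  with Suc assms(1) have "continuous_on S (f \<circ> (f ^^ k))"
    by (intro continuous_on_compose) (auto intro: continuous_on_subset)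
  then show ?case by simp
qed (simp add: id_def)

lemma funpow_image_closure_subset:
  assumes "closed Y" "continuous_on Y f" "f ` Y \<subseteq> Y" "x \<in> Y"
  shows "closure {(f ^^ k) x | k. True} \<subseteq> Y"
    and "f ` closure {(f ^^ k) x | k. True} \<subseteq> closure {(f ^^ k) x | k. True}"
proof -
  let ?O = "{(f ^^ k) x | k. True}"
  have "?O \<subseteq> Y"
    using funpow_invariant[OF assms(3,4)] by auto
  then show sub: "closure ?O \<subseteq> Y"
    using assms(1) by (simp add: closure_minimal)
  have "f ` ?O \<subseteq> ?O"
  proof clarify
    fix k show "\<exists>k'. f ((f ^^ k) x) = (f ^^ k') x \<and> True"
      by (rule exI[of _ "Suc k"]) simp
  qed
  then show "f ` closure ?O \<subseteq> closure ?O"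
    using image_closure_subset[OF continuous_on_subset[OF assms(2) sub] closed_closure]
      closure_subset[of ?O] by blast
qed

section \<open>Minimal sets\<close>

text \<open>Finite intersection property inside one member \<open>S\<close>: by the chain condition,
  any finitely many members together with \<open>S\<close> contain a common member of
  \<open>C\<close>, which is non-empty.\<close>

lemma compact_Inter_chain_nonempty:
  fixes C :: "'b::t2_space set set"
  assumes "C \<noteq> {}" "\<And>Y. Y \<in> C \<Longrightarrow> compact Y \<and> Y \<noteq> {}"
    and chain: "\<And>Y Z. Y \<in> C \<Longrightarrow> Z \<in> C \<Longrightarrow> Y \<subseteq> Z \<or> Z \<subseteq> Y"
  shows "\<Inter>C \<noteq> {}"
proof -
  obtain S where S: "S \<in> C" using assms(1) by blast
  have "S \<inter> \<Inter>C \<noteq> {}"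
  proof (rule compact_imp_fip)
    fix F assume F: "finite F" "F \<subseteq> C"
    have "\<exists>Z\<in>C. Z \<subseteq> S \<inter> \<Inter>F"
      using F
    proof (induction F)
      case empty then show ?case using S by auto
    next
      case (insert Y F)
      then obtain Z where Z: "Z \<in> C" "Z \<subseteq> S \<inter> \<Inter>F" by auto
      have "Y \<in> C" using insert.prems by simp
      then have "Y \<subseteq> Z \<or> Z \<subseteq> Y" using chain Z(1) by simp
      then have "(if Y \<subseteq> Z then Y else Z) \<subseteq> S \<inter> \<Inter>(insert Y F)"
        using Z(2) by auto
      with \<open>Y \<in> C\<close> Z(1) show ?case by (metis (full_types))
    qed
    then show "S \<inter> \<Inter>F \<noteq> {}" using assms(2) by blast
  qed (use S assms(2) in \<open>auto intro: compact_imp_closed\<close>)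
  then show ?thesis by blast
qed

text \<open>Zorn for reverse inclusion on the non-empty closed invariant subsets of
  \<open>K\<close>: a chain is bounded by its intersection, the empty chain by \<open>K\<close>. The
  generality of \<open>t2_space\<close> allows tuples, that is, functions with the product
  topology.\<close>

lemma exists_minimal_invariant_subset:
  fixes K :: "'b::t2_space set"
  assumes "compact K" "K \<noteq> {}" "f ` K \<subseteq> K"
  obtains M where "M \<subseteq> K" "closed M" "M \<noteq> {}" "f ` M \<subseteq> M"
    and "\<And>Y. Y \<subseteq> M \<Longrightarrow> closed Y \<Longrightarrow> Y \<noteq> {} \<Longrightarrow> f ` Y \<subseteq> Y \<Longrightarrow> Y = M"
proof -
  define A where "A = {Y. Y \<subseteq> K \<and> closed Y \<and> Y \<noteq> {} \<and> f ` Y \<subseteq> Y}"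
  have "\<exists>m\<in>A. \<forall>a\<in>A. a \<subseteq> m \<longrightarrow> a = m"
  proof (rule predicate_Zorn)
    show "partial_order_on A (relation_of (\<lambda>a b. b \<subseteq> a) A)"
      by (rule partial_order_on_relation_ofI) auto
    fix C assume "C \<in> Chains (relation_of (\<lambda>a b. b \<subseteq> a) A)"
    then have C: "C \<subseteq> A" "\<And>Y Z. Y \<in> C \<Longrightarrow> Z \<in> C \<Longrightarrow> Y \<subseteq> Z \<or> Z \<subseteq> Y"
      unfolding Chains_def relation_of_def by auto
    show "\<exists>u\<in>A. \<forall>a\<in>C. u \<subseteq> a"
    proof (cases "C = {}")
      case True
      then show ?thesis using assms by (auto simp: A_def intro: compact_imp_closed)
    next
      case False
      have "\<Inter>C \<noteq> {}"
      proof (rule compact_Inter_chain_nonempty[OF False])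
        fix Y assume "Y \<in> C"
        then have "Y \<subseteq> K" "closed Y" "Y \<noteq> {}" using C(1) by (auto simp: A_def)
        then show "compact Y \<and> Y \<noteq> {}"
          using compact_Int_closed[OF assms(1), of Y] by (simp add: Int_absorb1)
      qed (use C(2) in auto)
      moreover have "f ` \<Inter>C \<subseteq> \<Inter>C" "closed (\<Inter>C)" "\<Inter>C \<subseteq> K"
        using C(1) False unfolding A_def by (blast, auto)
      ultimately show ?thesis unfolding A_def by blast
    qed
  qed
  then obtain M where M: "M \<in> A" "\<And>Y. Y \<in> A \<Longrightarrow> Y \<subseteq> M \<Longrightarrow> Y = M" by blast
  have M': "M \<subseteq> K" "closed M" "M \<noteq> {}" "f ` M \<subseteq> M"
    using M(1) by (simp_all add: A_def)
  show ?thesis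
  proof (rule that[OF M'])
    fix Y assume Y: "Y \<subseteq> M" "closed Y" "Y \<noteq> {}" "f ` Y \<subseteq> Y"
    then have "Y \<in> A" using M'(1) unfolding A_def by simp
    then show "Y = M" using M(2) Y(1) by simp
  qed
qed

lemma orbit_closure_refl: "x \<in> orbit_closure T x"
proof -
  have "x \<in> {(T ^^ k) x | k. True}"
    by (auto intro: exI[of _ 0])
  then show ?thesis
    unfolding orbit_closure_def by (rule subsetD[OF closure_subset])
qed

text \<open>The orbit closure of \<open>x\<close> is a non-empty closed invariant subset of
  \<open>N\<close>, so by \<open>min\<close> it equals \<open>N\<close> and inherits its
  minimality.\<close>

lemma minimal_pointI:
  assumes "closed X" "continuous_on X T"
    and N: "N \<subseteq> X" "closed N" "T ` N \<subseteq> N" "x \<in> N"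
    and min: "\<And>Y. Y \<subseteq> N \<Longrightarrow> closed Y \<Longrightarrow> Y \<noteq> {} \<Longrightarrow> T ` Y \<subseteq> Y \<Longrightarrow> Y = N"
  shows "minimal_point X T x"
proof -
  have cont: "continuous_on N T"
    using assms(2) N(1) continuous_on_subset by blast
  have "orbit_closure T x \<subseteq> N" "T ` orbit_closure T x \<subseteq> orbit_closure T x"
    unfolding orbit_closure_def using funpow_image_closure_subset[OF N(2) cont N(3,4)] by auto
  then have eq: "orbit_closure T x = N"
    using min orbit_closure_refl[of x T] by (metis closed_closure empty_iff orbit_closure_def)
  show ?thesis
    unfolding minimal_point_def eq subsystem_def minimal_system_def
  proof (intro conjI notI)
    show "closedin (top_of_set X) N"
      using N assms(1) by (simp add: closed_subset)
    assume "\<exists>Y. (Y \<noteq> {} \<and> closedin (top_of_set N) Y \<and> T ` Y \<subseteq> Y) \<and> Y \<noteq> N"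
    then show False
      using min N(2) closedin_closed_trans closedin_imp_subset by metis
  qed (use N in auto)
qed

lemma minimal_point_orbit_closure:
  assumes "compact X" "minimal_point X T x"
  shows "compact (orbit_closure T x)" "orbit_closure T x \<subseteq> X"
    "T ` orbit_closure T x \<subseteq> orbit_closure T x"
proof -
  have *: "closedin (top_of_set X) (orbit_closure T x)"
    "T ` orbit_closure T x \<subseteq> orbit_closure T x"
    using assms(2) unfolding minimal_point_def subsystem_def by simp_all
  show "orbit_closure T x \<subseteq> X" using *(1) by (rule closedin_imp_subset)
  show "compact (orbit_closure T x)" using assms(1) *(1) by (rule closedin_compact)
  show "T ` orbit_closure T x \<subseteq> orbit_closure T x" by (rule *(2))
qed

lemma minimal_point_orbit_closure_minimal:
  assumes "minimal_point X T x"
    and "Y \<subseteq> orbit_closure T x" "closed Y" "Y \<noteq> {}" "T ` Y \<subseteq> Y"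
  shows "Y = orbit_closure T x"
proof -
  have "subsystem (orbit_closure T x) T Y"
    unfolding subsystem_def using assms(2-5) by (simp add: closed_subset)
  then show ?thesis
    using assms(1) unfolding minimal_point_def minimal_system_def by blast
qed

section \<open>Thickly separated tuples yield minimal points\<close>

text \<open>Tychonoff. Tuples are total functions on the index type, so that the product topology is
  the topology of the type itself.\<close>

lemma compact_Pi_UNIV:
  fixes X :: "'a::topological_space set"
  assumes "compact X"
  shows "compact {z :: 'i \<Rightarrow> 'a. \<forall>i. z i \<in> X}"
proof -
  have "{z :: 'i \<Rightarrow> 'a. \<forall>i. z i \<in> X} = PiE UNIV (\<lambda>_. X)"
    by (auto simp: PiE_UNIV_domain)
  then show ?thesis
    using assms compactin_PiE[of "\<lambda>_::'i. euclidean :: 'a topology" UNIV "\<lambda>_. X"]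
    by (simp add: euclidean_product_topology flip: compactin_euclidean_iff)
qed

text \<open>A non-empty closed invariant part \<open>Y\<close> of the \<open>i\<close>-th projection
  of \<open>M\<close> pulls back to such a part of \<open>M\<close>, hence to all of
  \<open>M\<close>. Thus the projection is itself minimal and contains \<open>w i\<close>.\<close>

lemma projection_of_minimal_point:
  fixes w :: "'i \<Rightarrow> 'a::metric_space"
  assumes X: "compact X" "continuous_on X T"
    and M: "M \<subseteq> {z. \<forall>i. z i \<in> X}" "closed M" "(\<lambda>z i. T (z i)) ` M \<subseteq> M"
    and min: "\<And>Y. Y \<subseteq> M \<Longrightarrow> closed Y \<Longrightarrow> Y \<noteq> {} \<Longrightarrow> (\<lambda>z i. T (z i)) ` Y \<subseteq> Y \<Longrightarrow> Y = M"
    and w: "w \<in> M"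
  shows "minimal_point X T (w i)"
proof (rule minimal_pointI[where N = "(\<lambda>z. z i) ` M"])
  have "compact M"
    using compact_Int_closed[OF compact_Pi_UNIV[OF X(1)] M(2)] M(1)
    by (metis inf.absorb_iff2)
  then have "compact ((\<lambda>z. z i) ` M)"
    by (intro compact_continuous_image continuous_on_product_coordinates)
      (auto intro: continuous_on_subset[OF continuous_on_product_coordinates])
  then show "closed ((\<lambda>z. z i) ` M)" by (rule compact_imp_closed)
  show "T ` (\<lambda>z. z i) ` M \<subseteq> (\<lambda>z. z i) ` M" using M(3) by force
  fix Y assume Y: "Y \<subseteq> (\<lambda>z. z i) ` M" "closed Y" "Y \<noteq> {}" "T ` Y \<subseteq> Y"
  have "closed ((\<lambda>z. z i) -` Y)"
    using Y(2) continuous_on_product_coordinates by (rule closed_vimage)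
  then have "{z\<in>M. z i \<in> Y} = M"
    using Y M(2,3) by (intro min) (auto simp: vimage_def Collect_conj_eq closed_Int)
  then show "Y = (\<lambda>z. z i) ` M" using Y(1) by auto
qed (use X M w in \<open>auto intro: compact_imp_closed\<close>)

text \<open>\<open>C\<close> consists of the tuples in \<open>X\<close> that stay separated at all
  times. Each single time is a closed condition on a compact space, and finitely many times fit into
  one window of the thick set, so the finite intersection property applies.\<close>

lemma thick_imp_separated_orbits:
  assumes X: "compact X" "continuous_on X T" "T ` X \<subseteq> X"
    and "n \<ge> 1"
    and x: "\<And>i. i \<in> {1..n} \<Longrightarrow> x i \<in> X"
    and thick: "thick {k. 1 \<le> k \<and>
      (\<forall>i\<in>{1..n}. \<forall>j\<in>{1..n}. i < j \<longrightarrow> \<delta> < dist ((T ^^ k) (x i)) ((T ^^ k) (x j)))}"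
  obtains C :: "(nat \<Rightarrow> 'a::metric_space) set" where "C \<subseteq> {z. \<forall>i. z i \<in> X}" "compact C" "C \<noteq> {}"
    "(\<lambda>z i. T (z i)) ` C \<subseteq> C"
    "\<And>z i j. z \<in> C \<Longrightarrow> i \<in> {1..n} \<Longrightarrow> j \<in> {1..n} \<Longrightarrow> i < j \<Longrightarrow> \<delta> \<le> dist (z i) (z j)"
proof -
  define K where "K = {z :: nat \<Rightarrow> 'a. \<forall>i. z i \<in> X}"
  \<comment> \<open>The inequality is weakened to \<le> here, since only then is the condition
    closed.\<close>
  define D where "D k = {z\<in>K. \<forall>i\<in>{1..n}. \<forall>j\<in>{1..n}. i < j \<longrightarrow>
    \<delta> \<le> dist ((T ^^ k) (z i)) ((T ^^ k) (z j))}" for k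
  define C where "C = K \<inter> (\<Inter>k. D k)"
  have K: "compact K" unfolding K_def by (rule compact_Pi_UNIV[OF X(1)])
  have coord: "continuous_on K (\<lambda>z. (T ^^ k) (z i))" for k i
    by (rule continuous_on_compose2[OF continuous_on_funpow_invariant[OF X(2,3)]])
      (auto simp: K_def intro: continuous_on_subset[OF continuous_on_product_coordinates])
  have closed_D: "closed (D k)" for k
  proof -
    \<comment> \<open>Pairs without \<open>i < j\<close> impose no condition and contribute
      \<open>UNIV\<close>.\<close>
    have "D k = K \<inter> (\<Inter>i\<in>{1..n}. \<Inter>j\<in>{1..n}. if i < j
      then K \<inter> (\<lambda>z. dist ((T ^^ k) (z i)) ((T ^^ k) (z j))) -` {\<delta>..} else UNIV)"
      unfolding D_def by (auto split: if_splits)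
    also have "closed \<dots>"
    proof (intro closed_Int closed_INT ballI)
      fix i j
      have "closed (K \<inter> (\<lambda>z. dist ((T ^^ k) (z i)) ((T ^^ k) (z j))) -` {\<delta>..})"
        by (rule continuous_closed_preimage[OF continuous_on_dist[OF coord coord]])
          (auto intro: compact_imp_closed K)
      then show "closed (if i < j
        then K \<inter> (\<lambda>z. dist ((T ^^ k) (z i)) ((T ^^ k) (z j))) -` {\<delta>..} else UNIV)"
        by simp
    qed (rule compact_imp_closed[OF K])
    finally show ?thesis .
  qed
  have C_ne: "C \<noteq> {}"
    unfolding C_def
  proof (rule compact_imp_fip_image[OF K closed_D])
    fix I :: "nat set" assume "finite I"
    then obtain L where L: "\<And>k. k \<in> I \<Longrightarrow> k \<le> L" by (auto simp: finite_nat_set_iff_bounded_le)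
    \<comment> \<open>\<open>Suc L\<close> rather than \<open>L\<close>, because
      \<open>thick\<close> speaks of lengths at least 1 and \<open>L\<close> may be 0.\<close>
    have "\<exists>m\<ge>1. {m..m + Suc L} \<subseteq> {k. 1 \<le> k \<and>
      (\<forall>i\<in>{1..n}. \<forall>j\<in>{1..n}. i < j \<longrightarrow> \<delta> < dist ((T ^^ k) (x i)) ((T ^^ k) (x j)))}"
      by (rule thick[unfolded thick_def, rule_format]) simp
    then obtain m where m: "m \<ge> 1" "{m..m + Suc L} \<subseteq> {k. 1 \<le> k \<and>
      (\<forall>i\<in>{1..n}. \<forall>j\<in>{1..n}. i < j \<longrightarrow> \<delta> < dist ((T ^^ k) (x i)) ((T ^^ k) (x j)))}"
      by blast
    \<comment> \<open>Shifting by \<open>m\<close> moves the window to time 0. Coordinates outside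
      \<open>{1..n}\<close> copy the first one merely to keep all of \<open>z\<close> in
      \<open>X\<close>.\<close>
    define z where "z i = (T ^^ m) (x (if i \<in> {1..n} then i else 1))" for i
    have "z \<in> K"
      unfolding K_def z_def using \<open>n \<ge> 1\<close> x by (auto intro!: funpow_invariant[OF X(3)])
    moreover have "z \<in> D k" if "k \<in> I" for k
    proof -
      have "k + m \<in> {m..m + Suc L}" using L[OF that] by simp
      then have "\<forall>i\<in>{1..n}. \<forall>j\<in>{1..n}. i < j \<longrightarrow>
        \<delta> < dist ((T ^^ (k + m)) (x i)) ((T ^^ (k + m)) (x j))"
        using m(2) by blast
      then show ?thesis
        using \<open>z \<in> K\<close> by (auto simp: D_def z_def funpow_add intro: less_imp_le)
    qed
    ultimately show "K \<inter> (\<Inter>k\<in>I. D k) \<noteq> {}" by blast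
  qed
  have C_compact: "compact C"
    unfolding C_def using K closed_D by (intro compact_Int_closed closed_INT) auto
  have C_inv: "(\<lambda>z i. T (z i)) ` C \<subseteq> C"
  proof clarify
    fix z assume z: "z \<in> C"
    have "(\<lambda>i. T (z i)) \<in> D k" for k
    proof -
      have "z \<in> D (Suc k)" using z unfolding C_def by blast
      then show ?thesis using X(3) unfolding D_def K_def by (auto simp: funpow_swap1)
    qed
    then show "(\<lambda>i. T (z i)) \<in> C" unfolding C_def by (auto simp: D_def)
  qed
  have C_sep: "\<delta> \<le> dist (z i) (z j)" if "z \<in> C" "i \<in> {1..n}" "j \<in> {1..n}" "i < j" for z i j
  proof -
    have "z \<in> D 0" using that(1) unfolding C_def by blast
    then show ?thesis using that unfolding D_def by simp
  qed
  have "C \<subseteq> {z. \<forall>i. z i \<in> X}" unfolding C_def K_def by (rule Int_lower1)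
  then show ?thesis using C_compact C_ne C_inv C_sep by (rule that)
qed

section \<open>Hitting times in weakly mixing systems\<close>

lemma omega_limit_hits_after:
  fixes V :: "'a::metric_space set"
  assumes "y \<in> omega_limit T x" "open V" "y \<in> V"
  shows "\<exists>k\<ge>m. (T ^^ k) x \<in> V"
proof -
  obtain k where k: "filterlim k at_top sequentially" "(\<lambda>i. (T ^^ k i) x) \<longlonglongrightarrow> y"
    using assms(1) unfolding omega_limit_def by blast
  have "\<forall>\<^sub>F i in sequentially. k i \<ge> m" "\<forall>\<^sub>F i in sequentially. (T ^^ k i) x \<in> V"
    using k assms(2,3) by (auto simp: filterlim_at_top dest: topological_tendstoD)
  then have "\<forall>\<^sub>F i in sequentially. k i \<ge> m \<and> (T ^^ k i) x \<in> V"
    by (rule eventually_conj)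
  then show ?thesis
    using eventually_happens' sequentially_bot by blast
qed

definition hitting_times :: "('a \<Rightarrow> 'a) \<Rightarrow> 'a set \<Rightarrow> 'a set \<Rightarrow> nat set" where
  "hitting_times T U V = {k. \<exists>x\<in>U. (T ^^ k) x \<in> V}"

lemma funpow_map_prod:
  fixes f :: "'a \<Rightarrow> 'a" and g :: "'b \<Rightarrow> 'b"
  shows "(map_prod f g ^^ k) (x, y) = ((f ^^ k) x, (g ^^ k) y)"
  by (induction k) auto

text \<open>The orbit of a transitive point meets \<open>U\<close> at some time \<open>a\<close> and
  meets \<open>V\<close> at arbitrarily late times, in particular at some \<open>b\<close> \<ge>
  \<open>a + m\<close>. Then \<open>b - a\<close> is a hitting time, witnessed by the point reached
  at time \<open>a\<close>.\<close>

lemma transitive_system_hitting_times: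
  fixes U V :: "'a::metric_space set"
  assumes tr: "transitive_system X T"
    and U: "openin (top_of_set X) U" "U \<noteq> {}"
    and V: "openin (top_of_set X) V" "V \<noteq> {}"
    and inv: "T ` X \<subseteq> X"
  shows "\<exists>k\<ge>m. k \<in> hitting_times T U V"
proof -
  obtain x where x: "x \<in> X" "omega_limit T x = X"
    using tr unfolding transitive_system_def by blast
  obtain U' V' where o: "open U'" "U = X \<inter> U'" "open V'" "V = X \<inter> V'"
    using U(1) V(1) by (auto simp: openin_open)
  obtain u v where "u \<in> U" "v \<in> V" using U V by blast
  with x o obtain a where a: "(T ^^ a) x \<in> U'"
    using omega_limit_hits_after[of u T x U'] by blast
  obtain b where b: "b \<ge> a + m" "(T ^^ b) x \<in> V'"
    using \<open>v \<in> V\<close> x o omega_limit_hits_after[of v T x V'] by blast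
  have "(T ^^ (b - a)) ((T ^^ a) x) = (T ^^ b) x"
    using b(1) by (simp flip: funpow_add[THEN fun_cong, unfolded o_apply])
  moreover have "(T ^^ k) x \<in> X" for k
    using inv x(1) by (rule funpow_invariant)
  ultimately have "b - a \<in> hitting_times T U V"
    unfolding hitting_times_def using a b(2) o by (auto intro!: bexI[of _ "(T ^^ a) x"])
  moreover have "b - a \<ge> m" using b(1) by simp
  ultimately show ?thesis by blast
qed

lemma weakly_mixing_hitting_times:
  fixes X :: "'a::metric_space set"
  assumes wm: "weakly_mixing X T" and inv: "T ` X \<subseteq> X"
    and U: "openin (top_of_set X) U1" "U1 \<noteq> {}" "openin (top_of_set X) U2" "U2 \<noteq> {}"
    and V: "openin (top_of_set X) V1" "V1 \<noteq> {}" "openin (top_of_set X) V2" "V2 \<noteq> {}"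
  shows "\<exists>k\<ge>m. k \<in> hitting_times T U1 V1 \<inter> hitting_times T U2 V2"
proof -
  have "\<exists>k\<ge>m. k \<in> hitting_times (map_prod T T) (U1 \<times> U2) (V1 \<times> V2)"
  proof (rule transitive_system_hitting_times)
    show "transitive_system (X \<times> X) (map_prod T T)"
      using wm by (simp add: weakly_mixing_def)
    show "openin (top_of_set (X \<times> X)) (U1 \<times> U2)" "openin (top_of_set (X \<times> X)) (V1 \<times> V2)"
      using U V by (auto intro: openin_Times)
  qed (use U V inv in auto)
  then show ?thesis
    by (auto simp: hitting_times_def funpow_map_prod)
qed

lemma openin_Int_funpow_vimage:
  assumes "continuous_on X T" "T ` X \<subseteq> X" "openin (top_of_set X) U" "openin (top_of_set X) V"
  shows "openin (top_of_set X) (U \<inter> (T ^^ k) -` V)"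
proof -
  have "openin (top_of_set X) (X \<inter> (T ^^ k) -` V)"
    using assms continuous_on_funpow_invariant[OF assms(1,2)] funpow_invariant[OF assms(2)]
    by (intro continuous_openin_preimage[where T = X]) auto
  then have "openin (top_of_set X) (U \<inter> (X \<inter> (T ^^ k) -` V))"
    using assms(3) by blast
  moreover have "U \<inter> (X \<inter> (T ^^ k) -` V) = U \<inter> (T ^^ k) -` V"
    using openin_imp_subset[OF assms(3)] by blast
  ultimately show ?thesis by simp
qed

text \<open>Furstenberg: in a weakly mixing system the sets of hitting times form a filter base, because
  \<open>N(U1 \<inter> T\<^sup>-\<^sup>kU2, V1 \<inter> T\<^sup>-\<^sup>kV2) \<subseteq> N(U1, V1) \<inter> N(U2, V2)\<close>.\<close>

lemma weakly_mixing_Int_hitting_times: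
  fixes X :: "'a::metric_space set"
  assumes sys: "weakly_mixing X T" "continuous_on X T" "T ` X \<subseteq> X"
    and U: "openin (top_of_set X) U1" "U1 \<noteq> {}" "openin (top_of_set X) U2" "U2 \<noteq> {}"
    and V: "openin (top_of_set X) V1" "V1 \<noteq> {}" "openin (top_of_set X) V2" "V2 \<noteq> {}"
  obtains U V where "openin (top_of_set X) U" "U \<noteq> {}" "openin (top_of_set X) V" "V \<noteq> {}"
    "hitting_times T U V \<subseteq> hitting_times T U1 V1 \<inter> hitting_times T U2 V2"
proof -
  \<comment> \<open>The sets are paired crosswise: one time carries a point of \<open>U1\<close>
    into \<open>U2\<close> and a point of \<open>V1\<close> into \<open>V2\<close>, which makes both
    new sets non-empty.\<close>
  obtain k where k: "k \<in> hitting_times T U1 U2" "k \<in> hitting_times T V1 V2"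
    using weakly_mixing_hitting_times[OF sys(1,3) U(1,2) V(1,2) U(3,4) V(3,4), of 0] by blast
  show ?thesis
  proof (rule that)
    show "openin (top_of_set X) (U1 \<inter> (T ^^ k) -` U2)" "openin (top_of_set X) (V1 \<inter> (T ^^ k) -` V2)"
      using openin_Int_funpow_vimage[OF sys(2,3)] U V by blast+
    show "U1 \<inter> (T ^^ k) -` U2 \<noteq> {}" "V1 \<inter> (T ^^ k) -` V2 \<noteq> {}"
      using k by (auto simp: hitting_times_def)
    show "hitting_times T (U1 \<inter> (T ^^ k) -` U2) (V1 \<inter> (T ^^ k) -` V2)
      \<subseteq> hitting_times T U1 V1 \<inter> hitting_times T U2 V2"
    proof
      fix j assume "j \<in> hitting_times T (U1 \<inter> (T ^^ k) -` U2) (V1 \<inter> (T ^^ k) -` V2)"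
      then obtain x where x: "x \<in> U1" "(T ^^ k) x \<in> U2" "(T ^^ j) x \<in> V1"
        "(T ^^ k) ((T ^^ j) x) \<in> V2"
        by (auto simp: hitting_times_def)
      have "(T ^^ k) ((T ^^ j) x) = (T ^^ j) ((T ^^ k) x)"
        by (metis add.commute comp_apply funpow_add)
      with x show "j \<in> hitting_times T U1 V1 \<inter> hitting_times T U2 V2"
        by (auto simp: hitting_times_def)
    qed
  qed
qed

text \<open>The induction produces not a time but a pair of open sets whose hitting times belong to
  all the given sets; arbitrarily late times are drawn from that pair at the end.\<close>

lemma weakly_mixing_INT_hitting_times:
  fixes X :: "'a::metric_space set"
  assumes sys: "weakly_mixing X T" "continuous_on X T" "T ` X \<subseteq> X"
    and "finite I"
    and UV: "\<And>i. i \<in> I \<Longrightarrow> openin (top_of_set X) (U i) \<and> U i \<noteq> {}"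
      "\<And>i. i \<in> I \<Longrightarrow> openin (top_of_set X) (V i) \<and> V i \<noteq> {}"
  shows "\<exists>k\<ge>m. \<forall>i\<in>I. k \<in> hitting_times T (U i) (V i)"
proof -
  have "X \<noteq> {}"
    using sys(1) unfolding weakly_mixing_def transitive_system_def by blast
  have "\<exists>A B. openin (top_of_set X) A \<and> A \<noteq> {} \<and> openin (top_of_set X) B \<and> B \<noteq> {} \<and>
    (\<forall>i\<in>I. hitting_times T A B \<subseteq> hitting_times T (U i) (V i))"
    using \<open>finite I\<close> UV
  proof (induction I)
    case empty
    then show ?case using \<open>X \<noteq> {}\<close> by (intro exI[of _ X]) auto
  next
    case (insert i I)
    obtain A B where AB: "openin (top_of_set X) A" "A \<noteq> {}" "openin (top_of_set X) B" "B \<noteq> {}"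
      "\<forall>i\<in>I. hitting_times T A B \<subseteq> hitting_times T (U i) (V i)"
      using insert.IH insert.prems by (metis insertCI)
    have i: "openin (top_of_set X) (U i)" "U i \<noteq> {}" "openin (top_of_set X) (V i)" "V i \<noteq> {}"
      using insert.prems by auto
    show ?case
      by (rule weakly_mixing_Int_hitting_times[OF sys AB(1,2) i(1,2) AB(3,4) i(3,4)])
        (use AB(5) in blast)
  qed
  then obtain A B where AB: "openin (top_of_set X) A" "A \<noteq> {}" "openin (top_of_set X) B" "B \<noteq> {}"
    "\<forall>i\<in>I. hitting_times T A B \<subseteq> hitting_times T (U i) (V i)"
    by blast
  \<comment> \<open>Both factors of the product system receive the same pair \<open>A\<close>,
    \<open>B\<close>.\<close>
  then show ?thesis
    using weakly_mixing_hitting_times[OF sys(1,3) AB(1,2,1-4,3,4), of m] by blast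
qed

lemma openin_shrink_closure:
  fixes U :: "'a::metric_space set"
  assumes "closed X" "openin (top_of_set X) U" "U \<noteq> {}"
  obtains W where "openin (top_of_set X) W" "W \<noteq> {}" "closure W \<subseteq> U"
proof -
  obtain O' where O': "open O'" "U = X \<inter> O'"
    using assms(2) by (auto simp: openin_open)
  obtain x where x: "x \<in> X" "x \<in> O'" using assms(3) O' by blast
  obtain e where e: "e > 0" "cball x e \<subseteq> O'"
    using O'(1) x(2) open_contains_cball by blast
  show ?thesis
  proof (rule that[of "X \<inter> ball x e"])
    have "closure (X \<inter> ball x e) \<subseteq> X \<inter> cball x e"
      using assms(1) by (intro closure_minimal) auto
    then show "closure (X \<inter> ball x e) \<subseteq> U" using e O' by blast
  qed (use x e in \<open>auto simp: openin_open\<close>)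
qed

text \<open>The points are fixed before \<open>L\<close>: one tuple has to serve every window
  length, because thickness is demanded of the set of times of a single tuple. The time
  \<open>m\<close> may depend on \<open>L\<close> but is common to all \<open>i\<close>.\<close>

lemma weakly_mixing_simultaneous_visits:
  fixes X :: "'a::metric_space set" and V :: "nat \<Rightarrow> 'i \<Rightarrow> 'a set"
  assumes sys: "weakly_mixing X T" "compact X" "continuous_on X T" "T ` X \<subseteq> X"
    and "finite I"
    and U: "openin (top_of_set X) U" "U \<noteq> {}"
    and V: "\<And>L i. i \<in> I \<Longrightarrow> openin (top_of_set X) (V L i)" "\<And>L i. i \<in> I \<Longrightarrow> V L i \<noteq> {}"
  obtains x where "\<And>i. i \<in> I \<Longrightarrow> x i \<in> U"
    "\<And>L. \<exists>m\<ge>1. \<forall>i\<in>I. (T ^^ m) (x i) \<in> V L i"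
proof -
  \<comment> \<open>A Baire category argument: \<open>x i\<close> is taken from a nested sequence of open sets, the \<open>L\<close>-th of
    which secures the visit to \<open>V L i\<close>.\<close>
  define P where "P W \<longleftrightarrow> (\<forall>i\<in>I. openin (top_of_set X) (W i) \<and> W i \<noteq> {} \<and> W i \<subseteq> U)"
    for W :: "'i \<Rightarrow> 'a set"
  define Q where "Q L W W' \<longleftrightarrow> (\<forall>i\<in>I. closure (W' i) \<subseteq> W i) \<and>
    (\<exists>m\<ge>1. \<forall>i\<in>I. W' i \<subseteq> (T ^^ m) -` V L i)" for L and W W' :: "'i \<Rightarrow> 'a set"
  have "\<exists>W. \<forall>L. P (W L) \<and> Q L (W L) (W (Suc L))"
  proof (rule dependent_nat_choice)
    show "\<exists>W. P W" using U by (intro exI[of _ "\<lambda>_. U"]) (simp add: P_def)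
    fix W L assume W: "P W"
    obtain m where m: "m \<ge> 1" "\<forall>i\<in>I. m \<in> hitting_times T (W i) (V L i)"
      using weakly_mixing_INT_hitting_times[OF sys(1,3,4) \<open>finite I\<close>, of W "V L" 1] W V
      unfolding P_def by blast
    have "\<exists>A. openin (top_of_set X) A \<and> A \<noteq> {} \<and> closure A \<subseteq> W i \<inter> (T ^^ m) -` V L i"
      if "i \<in> I" for i
    proof (rule openin_shrink_closure)
      show "openin (top_of_set X) (W i \<inter> (T ^^ m) -` V L i)"
        using W V that sys unfolding P_def by (intro openin_Int_funpow_vimage) auto
      show "W i \<inter> (T ^^ m) -` V L i \<noteq> {}"
        using m(2) that by (auto simp: hitting_times_def)
      show "closed X" using sys(2) by (rule compact_imp_closed)
    qed blast
    then obtain W' where W': "\<And>i. i \<in> I \<Longrightarrow> openin (top_of_set X) (W' i) \<and> W' i \<noteq> {} \<and>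
      closure (W' i) \<subseteq> W i \<inter> (T ^^ m) -` V L i"
      by metis
    have "W' i \<subseteq> W i \<inter> (T ^^ m) -` V L i" if "i \<in> I" for i
      using W'[OF that] closure_subset[of "W' i"] by blast
    then have "P W' \<and> Q L W W'"
      using W W' m(1) unfolding P_def Q_def by blast
    then show "\<exists>W'. P W' \<and> Q L W W'" by blast
  qed
  then obtain W where W: "\<And>L. P (W L)" "\<And>L. Q L (W L) (W (Suc L))" by blast
  have "\<exists>x. \<forall>L. x \<in> W L i" if "i \<in> I" for i
  proof -
    have sub: "closure (W (Suc L) i) \<subseteq> W L i" for L
      using W(2)[of L] that unfolding Q_def by blast
    \<comment> \<open>The index is shifted because \<open>closure (W (Suc L) i)\<close> lies in
      \<open>W L i\<close>, so a point of all these closures lies in every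
      \<open>W L i\<close>.\<close>
    have "X \<inter> (\<Inter>L. closure (W (Suc L) i)) \<noteq> {}"
    proof (rule compact_imp_fip_image[OF sys(2) closed_closure])
      fix J :: "nat set" assume "finite J"
      then obtain L where L: "\<And>k. k \<in> J \<Longrightarrow> k \<le> L" by (auto simp: finite_nat_set_iff_bounded_le)
      have "W (Suc k) i \<subseteq> W k i" for k
        using sub[of k] closure_subset by blast
      then have dec: "W b i \<subseteq> W a i" if "a \<le> b" for a b
        using that by (rule lift_Suc_antimono_le)
      have W_Suc: "openin (top_of_set X) (W (Suc L) i)" "W (Suc L) i \<noteq> {}"
        using W(1)[of "Suc L"] \<open>i \<in> I\<close> unfolding P_def by simp_all
      then obtain y where y: "y \<in> W (Suc L) i" by blast
      have "y \<in> closure (W (Suc k) i)" if "k \<in> J" for k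
        using subsetD[OF dec[of "Suc k" "Suc L"] y] L[OF that] subsetD[OF closure_subset] by simp
      moreover have "y \<in> X"
        using openin_imp_subset[OF W_Suc(1)] y by (rule subsetD)
      ultimately show "X \<inter> (\<Inter>L\<in>J. closure (W (Suc L) i)) \<noteq> {}" by blast
    qed
    then obtain x where "x \<in> (\<Inter>L. closure (W (Suc L) i))" by blast
    then have "x \<in> W L i" for L using subsetD[OF sub[of L]] by simp
    then show ?thesis by blast
  qed
  then obtain x where x: "\<And>i L. i \<in> I \<Longrightarrow> x i \<in> W L i" by metis
  show ?thesis
  proof (rule that[of x])
    show "x i \<in> U" if "i \<in> I" for i
      using x[OF that, of 0] W(1)[of 0] that unfolding P_def by blast
    show "\<exists>m\<ge>1. \<forall>i\<in>I. (T ^^ m) (x i) \<in> V L i" for L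
      using W(2)[of L] x unfolding Q_def by (meson subsetD vimage_eq)
  qed
qed

section \<open>Uniformly separated orbits\<close>

lemma finite_uniform_lower_bound:
  fixes f :: "'p \<Rightarrow> 'z \<Rightarrow> real"
  assumes "finite P" "\<And>p. p \<in> P \<Longrightarrow> \<exists>e>0. \<forall>z\<in>S. e \<le> f p z"
  shows "\<exists>e>0. \<forall>p\<in>P. \<forall>z\<in>S. e \<le> f p z"
  using assms
proof (induction P)
  case (insert p P)
  obtain e where "e > 0" "\<forall>p\<in>P. \<forall>z\<in>S. e \<le> f p z"
    using insert by blast
  moreover obtain e' where "e' > 0" "\<forall>z\<in>S. e' \<le> f p z"
    using insert.prems by blast
  ultimately show ?case
    by (intro exI[of _ "min e e'"]) (auto simp: min_le_iff_disj)
qed (auto intro: exI[of _ 1])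

lemma periodic_points_common_period:
  assumes "finite M" "\<And>p. p \<in> M \<Longrightarrow> \<exists>m\<ge>1. (T ^^ m) p = p"
  shows "\<exists>N\<ge>1::nat. \<forall>p\<in>M. (T ^^ N) p = p"
  using assms
proof (induction M)
  case (insert p M)
  have mult: "(T ^^ (a * b)) y = y" if "(T ^^ a) y = y" for a b y
    using funpow_mod_eq[OF that, of "a * b"] by simp
  obtain N where N: "N \<ge> 1" "\<forall>q\<in>M. (T ^^ N) q = q" using insert by blast
  obtain m where m: "m \<ge> 1" "(T ^^ m) p = p" using insert.prems by blast
  have "\<forall>q\<in>insert p M. (T ^^ (N * m)) q = q"
    using mult[of N _ m] mult[OF m(2), of N] N(2) by (auto simp: mult.commute)
  moreover have "N * m \<ge> 1" using N(1) m(1) by simp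
  ultimately show ?case by blast
qed auto

text \<open>A common period \<open>N\<close> leaves only finitely many distances to bound, those at
  times below \<open>N\<close>. They are positive because distinct periodic points never
  merge.\<close>

lemma periodic_points_separated:
  fixes T :: "'a::metric_space \<Rightarrow> 'a"
  assumes "finite M" "\<And>p. p \<in> M \<Longrightarrow> \<exists>m\<ge>1. (T ^^ m) p = p"
  shows "\<exists>e>0. \<forall>p\<in>M. \<forall>q\<in>M. p \<noteq> q \<longrightarrow> (\<forall>k. e \<le> dist ((T ^^ k) p) ((T ^^ k) q))"
proof -
  obtain N where N: "N \<ge> 1" "\<And>p. p \<in> M \<Longrightarrow> (T ^^ N) p = p"
    using periodic_points_common_period[OF assms] by blast
  define P where "P = {(p, q) \<in> M \<times> M. p \<noteq> q} \<times> {..<N}"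
  have "finite P"
    unfolding P_def using assms(1)
    by (intro finite_cartesian_product) (auto intro: finite_subset[of _ "M \<times> M"])
  \<comment> \<open>The time is part of the finite index \<open>t\<close>, so the parameter of the
    uniform bound ranges over a single dummy value.\<close>
  moreover have "\<exists>e>0. \<forall>z\<in>{()}. e \<le> (case t of ((p, q), k) \<Rightarrow> dist ((T ^^ k) p) ((T ^^ k) q))"
    if "t \<in> P" for t
  proof -
    obtain p q k where t: "t = ((p, q), k)" "p \<in> M" "q \<in> M" "p \<noteq> q" "k < N"
      using \<open>t \<in> P\<close> unfolding P_def by auto
    have "(T ^^ k) p \<noteq> (T ^^ k) q"
    proof
      assume "(T ^^ k) p = (T ^^ k) q"
      \<comment> \<open>Running on to time \<open>N\<close> returns both points to their starting
        positions.\<close>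
      then have "(T ^^ (N - k + k)) p = (T ^^ (N - k + k)) q"
        unfolding funpow_add by simp
      then show False using t N(2) by simp
    qed
    then show ?thesis
      unfolding t(1) by (intro exI[of _ "dist ((T ^^ k) p) ((T ^^ k) q)"]) simp
  qed
  ultimately obtain e where e: "e > 0"
    "\<forall>t\<in>P. \<forall>z\<in>{()}. e \<le> (case t of ((p, q), k) \<Rightarrow> dist ((T ^^ k) p) ((T ^^ k) q))"
    using finite_uniform_lower_bound[of P "{()}"
      "\<lambda>t _. case t of ((p, q), k) \<Rightarrow> dist ((T ^^ k) p) ((T ^^ k) q)"] by blast
  have "e \<le> dist ((T ^^ k) p) ((T ^^ k) q)" if "p \<in> M" "q \<in> M" "p \<noteq> q" for p q k
  proof -
    have "((p, q), k mod N) \<in> P"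
      using that N(1) unfolding P_def by simp
    then have "e \<le> dist ((T ^^ (k mod N)) p) ((T ^^ (k mod N)) q)"
      using e(2) by fastforce
    then show ?thesis
      using that by (simp add: funpow_mod_eq[OF N(2)])
  qed
  with e(1) show ?thesis by blast
qed

text \<open>The orbit of a periodic \<open>y\<close> is finite, hence closed, and invariant. By
  minimality it would be the whole orbit closure, so \<open>x\<close> would lie on it and be
  periodic too.\<close>

lemma nonperiodic_minimal_point_orbit_closure:
  fixes X :: "'a::metric_space set"
  assumes "compact X" and x: "minimal_point X T x" and nonper: "\<And>m. m \<ge> 1 \<Longrightarrow> (T ^^ m) x \<noteq> x"
    and y: "y \<in> orbit_closure T x" "m \<ge> 1"
  shows "(T ^^ m) y \<noteq> y"
proof
  assume per: "(T ^^ m) y = y"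
  note oc = minimal_point_orbit_closure[OF assms(1) x]
  define O' where "O' = range (\<lambda>k. (T ^^ k) y)"
  have "O' \<subseteq> (\<lambda>k. (T ^^ k) y) ` {..<m}"
  proof
    fix z assume "z \<in> O'"
    then obtain k where "z = (T ^^ (k mod m)) y"
      unfolding O'_def by (auto simp: funpow_mod_eq[OF per])
    then show "z \<in> (\<lambda>k. (T ^^ k) y) ` {..<m}"
      using y(2) by auto
  qed
  then have "closed O'"
    using finite_subset by (intro finite_imp_closed) blast
  moreover have "T ` O' \<subseteq> O'"
    unfolding O'_def using rangeI[of "\<lambda>k. (T ^^ k) y" "Suc _"] by auto
  moreover have "O' \<subseteq> orbit_closure T x"
    unfolding O'_def using funpow_invariant[OF oc(3) y(1)] by blast
  ultimately have "O' = orbit_closure T x"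
    by (intro minimal_point_orbit_closure_minimal[OF x]) (auto simp: O'_def)
  then obtain k where k: "x = (T ^^ k) y"
    using orbit_closure_refl[of x T] unfolding O'_def by auto
  have "(T ^^ m) x = (T ^^ k) ((T ^^ m) y)"
    unfolding k by (metis add.commute comp_apply funpow_add)
  then show False
    using nonper[OF y(2)] per k by simp
qed

text \<open>On the compact orbit closure the distance between \<open>(T ^^ i) z\<close> and
  \<open>(T ^^ j) z\<close> attains a minimum. As iterates commute, evaluating it at
  \<open>z = (T ^^ k) x\<close> bounds the distance at every time \<open>k\<close>.\<close>

lemma nonperiodic_minimal_point_separated:
  fixes X :: "'a::metric_space set"
  assumes X: "compact X" "continuous_on X T"
    and x: "minimal_point X T x" and nonper: "\<And>m. m \<ge> 1 \<Longrightarrow> (T ^^ m) x \<noteq> x"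
  shows "\<exists>e>0. \<forall>i\<in>{1..n::nat}. \<forall>j\<in>{1..n}. i < j \<longrightarrow>
    (\<forall>k. e \<le> dist ((T ^^ k) ((T ^^ i) x)) ((T ^^ k) ((T ^^ j) x)))"
proof -
  define Y where "Y = orbit_closure T x"
  note oc = minimal_point_orbit_closure[OF X(1) x, folded Y_def]
  have "x \<in> Y" unfolding Y_def by (rule orbit_closure_refl)
  have cont: "continuous_on Y (T ^^ i)" for i
    using continuous_on_funpow_invariant[OF continuous_on_subset[OF X(2) oc(2)] oc(3)] .
  define P where "P = {(i, j) \<in> {1..n} \<times> {1..n}. i < j}"
  have "finite P" unfolding P_def by (auto intro: finite_subset[of _ "{1..n} \<times> {1..n}"])
  moreover have "\<exists>e>0. \<forall>z\<in>Y. e \<le> (case p of (i, j) \<Rightarrow> dist ((T ^^ i) z) ((T ^^ j) z))"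
    if "p \<in> P" for p
  proof -
    obtain i j where p: "p = (i, j)" "i < j" using \<open>p \<in> P\<close> unfolding P_def by auto
    obtain z where z: "z \<in> Y"
      "\<And>z'. z' \<in> Y \<Longrightarrow> dist ((T ^^ i) z) ((T ^^ j) z) \<le> dist ((T ^^ i) z') ((T ^^ j) z')"
      using continuous_attains_inf[OF oc(1) _ continuous_on_dist[OF cont cont]] \<open>x \<in> Y\<close> by blast
    have "(T ^^ i) z \<in> Y" using oc(3) z(1) by (rule funpow_invariant)
    \<comment> \<open>The minimum is positive: if \<open>(T ^^ i) z\<close> and
      \<open>(T ^^ j) z\<close> were equal, \<open>(T ^^ i) z\<close> would have period
      \<open>j - i\<close>.\<close>
    then have "(T ^^ (j - i)) ((T ^^ i) z) \<noteq> (T ^^ i) z"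
      using p(2) unfolding Y_def
      by (intro nonperiodic_minimal_point_orbit_closure[OF X(1) x nonper]) auto
    moreover have "(T ^^ (j - i)) ((T ^^ i) z) = (T ^^ j) z"
      using p(2) by (simp flip: funpow_add[THEN fun_cong, unfolded o_apply])
    ultimately show ?thesis
      using z(2) p(1) by (intro exI[of _ "dist ((T ^^ i) z) ((T ^^ j) z)"]) auto
  qed
  ultimately obtain e where e: "e > 0"
    "\<forall>p\<in>P. \<forall>z\<in>Y. e \<le> (case p of (i, j) \<Rightarrow> dist ((T ^^ i) z) ((T ^^ j) z))"
    using finite_uniform_lower_bound[of P Y
      "\<lambda>p z. case p of (i, j) \<Rightarrow> dist ((T ^^ i) z) ((T ^^ j) z)"] by blast
  have "e \<le> dist ((T ^^ k) ((T ^^ i) x)) ((T ^^ k) ((T ^^ j) x))"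
    if "i \<in> {1..n}" "j \<in> {1..n}" "i < j" for i j k
  proof -
    have "(T ^^ k) x \<in> Y" using oc(3) \<open>x \<in> Y\<close> by (rule funpow_invariant)
    moreover have "(i, j) \<in> P" using that unfolding P_def by simp
    ultimately have "e \<le> dist ((T ^^ i) ((T ^^ k) x)) ((T ^^ j) ((T ^^ k) x))"
      using e(2) by fastforce
    moreover have "(T ^^ k) ((T ^^ l) x) = (T ^^ l) ((T ^^ k) x)" for l
      by (metis add.commute comp_apply funpow_add)
    ultimately show ?thesis by simp
  qed
  with e(1) show ?thesis by blast
qed

lemma minimal_points_imp_separated_orbits:
  fixes X :: "'a::metric_space set"
  assumes X: "compact X" "continuous_on X T" "T ` X \<subseteq> X"
    and M: "M \<subseteq> {x. minimal_point X T x}" "finite M" "card M = n"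
  shows "\<exists>q :: nat \<Rightarrow> 'a. \<exists>e>0. (\<forall>i\<in>{1..n}. q i \<in> X) \<and>
    (\<forall>i\<in>{1..n}. \<forall>j\<in>{1..n}. i < j \<longrightarrow> (\<forall>k. e \<le> dist ((T ^^ k) (q i)) ((T ^^ k) (q j))))"
proof (cases "\<forall>p\<in>M. \<exists>m\<ge>1. (T ^^ m) p = p")
  case True
  then obtain e where e: "e > 0"
    "\<forall>p\<in>M. \<forall>q\<in>M. p \<noteq> q \<longrightarrow> (\<forall>k. e \<le> dist ((T ^^ k) p) ((T ^^ k) q))"
    using periodic_points_separated[OF M(2), of T] by blast
  obtain q where q: "bij_betw q {1..n} M"
    using ex_bij_betw_nat_finite_1[OF M(2)] M(3) by blast
  have qM: "q i \<in> M" if "i \<in> {1..n}" for i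
    using q that by (rule bij_betw_apply)
  have "q i \<noteq> q j" if "i \<in> {1..n}" "j \<in> {1..n}" "i < j" for i j
    using q that by (metis bij_betw_imp_inj_on inj_on_eq_iff less_irrefl)
  moreover have "q i \<in> X" if "i \<in> {1..n}" for i
    using qM[OF that] M(1) unfolding minimal_point_def by blast
  ultimately show ?thesis
    using e qM by (intro exI[of _ q] exI[of _ e]) blast
next
  case False
  \<comment> \<open>From here on \<open>M\<close> supplies only this one point; its iterates serve
    as all \<open>n\<close> points.\<close>
  then obtain x where x: "x \<in> M" "\<And>m. m \<ge> 1 \<Longrightarrow> (T ^^ m) x \<noteq> x" by blast
  then have min: "minimal_point X T x" using M(1) by blast
  then have "x \<in> X" unfolding minimal_point_def by blast
  then have "(T ^^ i) x \<in> X" for i using X(3) by (intro funpow_invariant)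
  moreover have "\<exists>e>0. \<forall>i\<in>{1..n}. \<forall>j\<in>{1..n}. i < j \<longrightarrow>
    (\<forall>k. e \<le> dist ((T ^^ k) ((T ^^ i) x)) ((T ^^ k) ((T ^^ j) x)))"
    using X(1,2) min x(2) by (rule nonperiodic_minimal_point_separated)
  ultimately show ?thesis
    by (intro exI[of _ "\<lambda>i. (T ^^ i) x"]) simp
qed

text \<open>These are Bowen balls: finite intersections of preimages of balls under the iterates up
  to \<open>L\<close>.\<close>

lemma openin_tracking:
  fixes X :: "'a::metric_space set"
  assumes "continuous_on X T" "T ` X \<subseteq> X"
  shows "openin (top_of_set X) {y\<in>X. \<forall>k\<le>L::nat. dist ((T ^^ k) y) ((T ^^ k) q) < e}"
proof -
  have "openin (top_of_set X) (X \<inter> (\<Inter>k\<in>{..L}. X \<inter> (T ^^ k) -` ball ((T ^^ k) q) e))"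
    using continuous_on_funpow_invariant[OF assms]
    by (intro openin_Int openin_INT2 continuous_openin_preimage_gen) auto
  moreover have "X \<inter> (\<Inter>k\<in>{..L}. X \<inter> (T ^^ k) -` ball ((T ^^ k) q) e) =
    {y\<in>X. \<forall>k\<le>L. dist ((T ^^ k) y) ((T ^^ k) q) < e}"
    by (auto simp: dist_commute)
  ultimately show ?thesis by simp
qed

section \<open>Sensitivity\<close>

lemma Min_pairs_gr_iff:
  fixes f :: "nat \<Rightarrow> nat \<Rightarrow> 'b::linorder"
  assumes "n \<ge> 2"
  shows "Min {f i j | i j. 1 \<le> i \<and> i < j \<and> j \<le> n} > \<delta> \<longleftrightarrow>
    (\<forall>i\<in>{1..n}. \<forall>j\<in>{1..n}. i < j \<longrightarrow> \<delta> < f i j)"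
proof -
  let ?S = "{f i j | i j. 1 \<le> i \<and> i < j \<and> j \<le> n}"
  have "?S \<subseteq> (\<lambda>(i, j). f i j) ` ({1..n} \<times> {1..n})" by force
  then have "finite ?S" by (rule finite_subset) simp
  \<comment> \<open>Here \<open>n\<close> \<ge> 2 makes the minimum one over a non-empty
    set.\<close>
  moreover have "f 1 2 \<in> ?S" using assms by force
  ultimately have "Min ?S > \<delta> \<longleftrightarrow> (\<forall>a\<in>?S. \<delta> < a)"
    by (intro Min_gr_iff) auto
  also have "\<dots> \<longleftrightarrow> (\<forall>i\<in>{1..n}. \<forall>j\<in>{1..n}. i < j \<longrightarrow> \<delta> < f i j)"
    by fastforce
  finally show ?thesis .
qed

lemma tuplewise_thickly_sensitive_iff:
  assumes "n \<ge> 2"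
  shows "tuplewise_thickly_sensitive n X T \<longleftrightarrow>
    (\<exists>\<delta>>0. \<forall>U. openin (top_of_set X) U \<and> U \<noteq> {} \<longrightarrow>
      (\<exists>x :: nat \<Rightarrow> 'a::metric_space. (\<forall>i\<in>{1..n}. x i \<in> U) \<and>
        thick {k. 1 \<le> k \<and>
          (\<forall>i\<in>{1..n}. \<forall>j\<in>{1..n}. i < j \<longrightarrow> \<delta> < dist ((T ^^ k) (x i)) ((T ^^ k) (x j)))}))"
  unfolding tuplewise_thickly_sensitive_def Min_pairs_gr_iff[OF assms] by (rule refl)

lemma separated_orbits_imp_sensitive:
  fixes X :: "'a::metric_space set" and q :: "nat \<Rightarrow> 'a"
  assumes sys: "weakly_mixing X T" "compact X" "continuous_on X T" "T ` X \<subseteq> X"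
    and "n \<ge> 2" "e > 0"
    and q: "\<And>i. i \<in> {1..n} \<Longrightarrow> q i \<in> X"
    and sep: "\<And>i j k. i \<in> {1..n} \<Longrightarrow> j \<in> {1..n} \<Longrightarrow> i < j \<Longrightarrow>
      e \<le> dist ((T ^^ k) (q i)) ((T ^^ k) (q j))"
  shows "tuplewise_thickly_sensitive n X T"
  unfolding tuplewise_thickly_sensitive_iff[OF \<open>n \<ge> 2\<close>]
\<comment> \<open>Two tracking errors below \<open>e / 4\<close> reduce a separation of
  \<open>e\<close> to more than \<open>e / 2\<close>, which exceeds the constant
  \<open>e / 4\<close>.\<close>
proof (intro exI[of _ "e / 4"] conjI allI impI)
  show "e / 4 > 0" using \<open>e > 0\<close> by simp
  fix U assume U: "openin (top_of_set X) U \<and> U \<noteq> {}"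
  define V where "V L i = {y\<in>X. \<forall>k\<le>L::nat. dist ((T ^^ k) y) ((T ^^ k) (q i)) < e / 4}" for L i
  obtain x where x: "\<And>i. i \<in> {1..n} \<Longrightarrow> x i \<in> U"
    "\<And>L. \<exists>m\<ge>1. \<forall>i\<in>{1..n}. (T ^^ m) (x i) \<in> V L i"
  proof (rule weakly_mixing_simultaneous_visits[OF sys, of "{1..n}" U V])
    show "openin (top_of_set X) (V L i)" for L i
      unfolding V_def using sys(3,4) by (rule openin_tracking)
    show "V L i \<noteq> {}" if "i \<in> {1..n}" for L i
      using q[OF that] \<open>e > 0\<close> unfolding V_def by force
  qed (use U in blast)+
  define F where "F = {k. 1 \<le> k \<and>
    (\<forall>i\<in>{1..n}. \<forall>j\<in>{1..n}. i < j \<longrightarrow> e / 4 < dist ((T ^^ k) (x i)) ((T ^^ k) (x j)))}"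
  have "\<exists>m\<ge>1. {m..m + L} \<subseteq> F" for L
  proof -
    obtain m where m: "m \<ge> 1" "\<forall>i\<in>{1..n}. (T ^^ m) (x i) \<in> V L i" using x(2) by blast
    have "k \<in> F" if k: "k \<in> {m..m + L}" for k
    proof -
      have "e / 4 < dist ((T ^^ k) (x i)) ((T ^^ k) (x j))"
        if ij: "i \<in> {1..n}" "j \<in> {1..n}" "i < j" for i j
      proof -
        \<comment> \<open>The orbit of \<open>q l\<close> is followed from time \<open>m\<close> on,
          so time \<open>k\<close> of \<open>x l\<close> corresponds to time \<open>k - m\<close> of
          \<open>q l\<close>.\<close>
        have near: "dist ((T ^^ k) (x l)) ((T ^^ (k - m)) (q l)) < e / 4" if "l \<in> {1..n}" for l
        proof -
          have "dist ((T ^^ (k - m)) ((T ^^ m) (x l))) ((T ^^ (k - m)) (q l)) < e / 4"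
            using m(2) that k unfolding V_def by auto
          moreover have "(T ^^ (k - m)) ((T ^^ m) (x l)) = (T ^^ k) (x l)"
            using k by (simp flip: funpow_add[THEN fun_cong, unfolded o_apply])
          ultimately show ?thesis by simp
        qed
        have "e \<le> dist ((T ^^ (k - m)) (q i)) ((T ^^ (k - m)) (q j))"
          using ij by (rule sep)
        also have "\<dots> \<le> dist ((T ^^ k) (x i)) ((T ^^ (k - m)) (q i)) +
          dist ((T ^^ k) (x i)) ((T ^^ k) (x j)) + dist ((T ^^ k) (x j)) ((T ^^ (k - m)) (q j))"
          using dist_triangle2[of "(T ^^ (k - m)) (q i)" "(T ^^ (k - m)) (q j)" "(T ^^ k) (x j)"]
            dist_triangle3[of "(T ^^ (k - m)) (q i)" "(T ^^ k) (x j)" "(T ^^ k) (x i)"]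
          by (simp add: dist_commute)
        finally show ?thesis using near[OF ij(1)] near[OF ij(2)] \<open>e > 0\<close> by linarith
      qed
      then show ?thesis using m(1) k unfolding F_def by simp
    qed
    with m(1) show ?thesis by blast
  qed
  then have "thick F" unfolding thick_def by blast
  with x(1) show "\<exists>x. (\<forall>i\<in>{1..n}. x i \<in> U) \<and> thick {k. 1 \<le> k \<and>
    (\<forall>i\<in>{1..n}. \<forall>j\<in>{1..n}. i < j \<longrightarrow> e / 4 < dist ((T ^^ k) (x i)) ((T ^^ k) (x j)))}"
    unfolding F_def by blast
qed

lemma sensitive_imp_minimal_points:
  fixes X :: "'a::metric_space set"
  assumes X: "compact X" "continuous_on X T" "T ` X \<subseteq> X" "X \<noteq> {}"
    and "n \<ge> 2" and sens: "tuplewise_thickly_sensitive n X T"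
  shows "\<exists>M. M \<subseteq> {x. minimal_point X T x} \<and> finite M \<and> card M = n"
proof -
  obtain \<delta> where \<delta>: "\<delta> > 0"
    "\<And>U. openin (top_of_set X) U \<and> U \<noteq> {} \<Longrightarrow>
      (\<exists>x :: nat \<Rightarrow> 'a. (\<forall>i\<in>{1..n}. x i \<in> U) \<and> thick {k. 1 \<le> k \<and>
        (\<forall>i\<in>{1..n}. \<forall>j\<in>{1..n}. i < j \<longrightarrow> \<delta> < dist ((T ^^ k) (x i)) ((T ^^ k) (x j)))})"
    using sens unfolding tuplewise_thickly_sensitive_iff[OF \<open>n \<ge> 2\<close>] by blast
  obtain x where x: "\<forall>i\<in>{1..n}. x i \<in> X" "thick {k. 1 \<le> k \<and>
    (\<forall>i\<in>{1..n}. \<forall>j\<in>{1..n}. i < j \<longrightarrow> \<delta> < dist ((T ^^ k) (x i)) ((T ^^ k) (x j)))}"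
    \<comment> \<open>Sensitivity is applied to the whole space as the open set.\<close>
    using \<delta>(2)[of X] X(4) by auto
  show ?thesis
  proof (rule thick_imp_separated_orbits[OF X(1-3) _ _ x(2)])
    fix C :: "(nat \<Rightarrow> 'a) set"
    assume C: "C \<subseteq> {z. \<forall>i. z i \<in> X}" "compact C" "C \<noteq> {}" "(\<lambda>z i. T (z i)) ` C \<subseteq> C"
      "\<And>z i j. z \<in> C \<Longrightarrow> i \<in> {1..n} \<Longrightarrow> j \<in> {1..n} \<Longrightarrow> i < j \<Longrightarrow> \<delta> \<le> dist (z i) (z j)"
    show ?thesis
    proof (rule exists_minimal_invariant_subset[OF C(2-4)])
      fix M assume M: "M \<subseteq> C" "closed M" "M \<noteq> {}" "(\<lambda>z i. T (z i)) ` M \<subseteq> M"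
        "\<And>Y. Y \<subseteq> M \<Longrightarrow> closed Y \<Longrightarrow> Y \<noteq> {} \<Longrightarrow> (\<lambda>z i. T (z i)) ` Y \<subseteq> Y \<Longrightarrow> Y = M"
      obtain w where w: "w \<in> M" using M(3) by blast
      have "minimal_point X T (w i)" for i
        using X(1,2) subset_trans[OF M(1) C(1)] M(2,4,5) w by (rule projection_of_minimal_point)
      \<comment> \<open>Injectivity turns the \<open>n\<close> coordinates of \<open>w\<close> into
        \<open>n\<close> different minimal points.\<close>
      moreover have "inj_on w {1..n}"
      proof (rule linorder_inj_onI)
        fix i j assume "i < j" "i \<in> {1..n}" "j \<in> {1..n}"
        then have "\<delta> \<le> dist (w i) (w j)" using C(5) subsetD[OF M(1) w] by simp
        then show "w i \<noteq> w j" using \<delta>(1) by auto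
      qed auto
      ultimately show ?thesis
        by (intro exI[of _ "w ` {1..n}"]) (auto simp: card_image)
    qed
  qed (use \<open>n \<ge> 2\<close> x(1) in auto)
qed

theorem theorem4p3:
  fixes X :: "'a::metric_space set" and T :: "'a \<Rightarrow> 'a" and n :: nat
  assumes "dynamical_system X T"
    and "nontrivial_system X"
    and "weakly_mixing X T"
    and "n \<ge> 2"
  shows "tuplewise_thickly_sensitive n X T \<longleftrightarrow>
    (\<exists>M. M \<subseteq> {x. minimal_point X T x} \<and> finite M \<and> card M = n)"
proof
  have X: "compact X" "continuous_on X T" "T ` X \<subseteq> X"
    using assms(1) by (simp_all add: dynamical_system_def)
  have "X \<noteq> {}"
    using assms(3) unfolding weakly_mixing_def transitive_system_def by blast
  then show "\<exists>M. M \<subseteq> {x. minimal_point X T x} \<and> finite M \<and> card M = n"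
    if "tuplewise_thickly_sensitive n X T"
    using sensitive_imp_minimal_points[OF X _ assms(4) that] by blast
  assume "\<exists>M. M \<subseteq> {x. minimal_point X T x} \<and> finite M \<and> card M = n"
  then obtain q :: "nat \<Rightarrow> 'a" and e where q: "e > 0" "\<forall>i\<in>{1..n}. q i \<in> X"
    "\<forall>i\<in>{1..n}. \<forall>j\<in>{1..n}. i < j \<longrightarrow> (\<forall>k. e \<le> dist ((T ^^ k) (q i)) ((T ^^ k) (q j)))"
    using minimal_points_imp_separated_orbits[OF X] by metis
  show "tuplewise_thickly_sensitive n X T"
    by (rule separated_orbits_imp_sensitive[OF assms(3) X assms(4) q(1)]) (use q in blast)+
qed

end
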